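(* Let $n=u+s$, let $f\in C^1(\mathbb R\times\mathbb R^n,\mathbb R^n)$, and consider $z'=f(t,z)$, $z=(x,y)\in\mathbb R^u\times\mathbb R^s$. Let $z_0\in\mathbb R^n$ satisfy $f(t,z_0)=0$ for all $t$. Let $N=\overline B_u(p_x,r_x)\times\overline B_s(p_y,r_y)$ with $z_0\in\operatorname{int}N$, let $t_0\in\mathbb R$, and let $Q(x,y)=a\|x\|^2-b\|y\|^2$ with $a,b>0$. Assume that $N$ is an isolating block for $z'=f(t,z)$ for $t\ge t_0$ and that the cone condition with respect to $Q$ holds on $N$ for $t\ge t_0$. Then, by the cone condition, there exists $E>0$ such that for all $t\ge t_0$ and $z\in N$ $$v^T\Big(\big(\tfrac{\partial f}{\partial z}(t,z)\big)^TQ+Q\,\tfrac{\partial f}{\partial z}(t,z)\Big)v\ \ge\ E\|v\|^2,\qquad v\in\mathbb R^n .$$ For such $E$, put $$m=\sup_{t\ge t_0,\ z\in N}\Big\|\big(\tfrac{\partial f}{\partial t}(t,z)\big)^TQ+Q\,\tfrac{\partial f}{\partial t}(t,z)\Big\|,\qquad \delta=\frac{a m^2}{E^2}.$$ If $t_1,t_2\ge t_0$ and $(x_i,y_i)\in W^s_{t_i,N}(z_0)$ for $i=1,2$, then $$a\|x_1-x_2\|^2\le\delta\,(t_1-t_2)^2+b\|y_1-y_2\|^2 .$$ In particular, if $W^s_{t,N}(z_0)=\{(x_s(t,y),y)\;|\;y\in\overline B_s(p_y,r_y)\}$, then for all $t_1,t_2\ge t_0$ (and $y\in\overline B_s(p_y,r_y)$)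 $$\|x_s(t_1,y)-x_s(t_2,y)\|\le\frac mE\,|t_1-t_2| .$$
   Context: Norms are Euclidean; $\overline B_k(p,r)$ is the closed ball in $\mathbb R^k$ of center $p$ and radius $r$. The same letter $Q$ denotes a quadratic form and its symmetric matrix, $Q(z)=z^TQz$. $\varphi(t,t_0,p)$ denotes the value at time $t$ of the solution of $z'=f(t,z)$ with $z(t_0)=p$. Norm in the definition of $m$: $\big(\tfrac{\partial f}{\partial t}\big)^TQ+Q\tfrac{\partial f}{\partial t}$ is understood as the bilinear map $(\tau,v)\in\mathbb R\times\mathbb R^n\mapsto \tau\big(\tfrac{\partial f}{\partial t}\big)^TQv+v^TQ\tfrac{\partial f}{\partial t}\tau\in\mathbb R$, and the norm of a bilinear map $M$ is $\max_{\|v\|\le1,\|w\|\le1}|M(v,w)|$; thus the norm equals $2\|Q\tfrac{\partial f}{\partial t}\|$. Local stable set: for $t_1\in\mathbb R$, $W^s_{t_1,N}(z_0)=\{z : \varphi(t_1+t,t_1,z)\in N\ \forall t\ge0,\ \lim_{t\to\infty}\varphi(t,t_1,z)=z_0\}$. Cone condition on $N$ for $t\ge t_0$: for each $t\ge t_0$, let $[D_zf(t,N)]$ be the set of $n\times n$ matrices $A$ with $A_{ij}\in[\inf_{z\in N}\partial f_i/\partial z_j(t,z),\ \sup_{z\in N}\partial f_i/\partial z_j(t,z)]$; the condition is that $A^TQ+QA$ is positive definite for every $A\in[D_zf(t,N)]$. Isolating block: put $N^-=\partial B_u(p_x,r_x)\times\overline B_s(p_y,r_y)$ (exit set) and $N^+=\overline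 B_u(p_x,r_x)\times\partial B_s(p_y,r_y)$ (entrance set). For an autonomous local flow $\psi$, a set $\Sigma$ is an $\eta$-section if $\psi((-\eta,\eta),\Sigma)$ is open and $\Sigma\times(-\eta,\eta)\ni(x,t)\mapsto\psi(t,x)\in\psi((-\eta,\eta),\Sigma)$ is a homeomorphism. $N$ is an isolating block for $t\in T\subset\mathbb R$ if there are $\eta>0$ and sets $\Sigma^\pm\supset N^\pm$ which are, for every $t_1\in T$, $\eta$-sections for the flow of the frozen vector field $f(t_1,\cdot)$, and such that for all $t_1\in T$: $\varphi(t_1+t,t_1,x)\notin N$ for $x\in N^+$, $t\in(-\eta,0)$, and $\varphi(t_1+t,t_1,x)\notin N$ for $x\in N^-$, $t\in(0,\eta)$. "For $t\ge t_0$" means $T=[t_0,\infty)$.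
   Formalization: The existence of E>0 for all t≥t_0 fails in general (f=e^{-t}(x,-y)); it is proved only on each compact interval [t_0,T], and the estimates are proved for every E>0 that satisfies the bound for all t≥t_0. *)

theory Defs
  imports "HOL-Analysis.Analysis"
begin

text \<open>
  The phase space is \<open>real ^ ('u + 's)\<close>, i.e. n-dimensional space with n = u + s. A point
  \<open>z = (x, y)\<close> is written \<open>join x y\<close>.
\<close>

definition join :: "real ^ 'u::finite \<Rightarrow> real ^ 's::finite \<Rightarrow> real ^ ('u + 's)" where
  "join x y = (\<chi> k. case k of Inl i \<Rightarrow> x $ i | Inr j \<Rightarrow> y $ j)"

definition C1 :: "('a::real_normed_vector \<Rightarrow> 'b::real_normed_vector) \<Rightarrow> bool" where
  "C1 g \<longleftrightarrow> (\<exists>g'. (\<forall>p. (g has_derivative blinfun_apply (g' p)) (at p)) \<and> continuous_on UNIV g')"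

definition pd_t :: "(real \<Rightarrow> real ^ 'n \<Rightarrow> real ^ 'n) \<Rightarrow> real \<Rightarrow> real ^ 'n \<Rightarrow> real ^ 'n" where
  "pd_t f t z = vector_derivative (\<lambda>\<tau>. f \<tau> z) (at t)"

definition pd_z :: "(real \<Rightarrow> real ^ 'n \<Rightarrow> real ^ 'n) \<Rightarrow> real \<Rightarrow> real ^ 'n \<Rightarrow> real ^ 'n ^ 'n" where
  "pd_z f t z = jacobian (f t) (at z)"

definition connects :: "(real \<Rightarrow> 'a::real_normed_vector \<Rightarrow> 'a) \<Rightarrow> real \<Rightarrow> 'a \<Rightarrow> real \<Rightarrow> 'a \<Rightarrow> bool" where
  "connects f t0 p t q \<longleftrightarrow>
     (\<exists>u. u t0 = p \<and> u t = q \<and>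
        (\<forall>\<tau>\<in>closed_segment t0 t.
           (u has_vector_derivative f \<tau> (u \<tau>)) (at \<tau> within closed_segment t0 t)))"

text \<open>
  \<open>phi f t t0 p\<close> is the value at time \<open>t\<close> of the solution of \<open>z' = f t z\<close> with
  \<open>z t0 = p\<close>. It is \<open>None\<close> if that solution does not extend from \<open>t0\<close> to \<open>t\<close>; here \<open>t < t0\<close>
  is allowed. The description is meaningful for right-hand sides with unique solutions.
\<close>

definition phi :: "(real \<Rightarrow> 'a::real_normed_vector \<Rightarrow> 'a) \<Rightarrow> real \<Rightarrow> real \<Rightarrow> 'a \<Rightarrow> 'a option" where
  "phi f t t0 p =
     (if \<exists>q. connects f t0 p t q then Some (THE q. connects f t0 p t q) else None)"

definition local_flow :: "('a::real_normed_vector \<Rightarrow> 'a) \<Rightarrow> real \<Rightarrow> 'a \<Rightarrow> 'a option" where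
  "local_flow g t p = phi (\<lambda>_. g) t 0 p"

definition stable_set ::
  "(real \<Rightarrow> 'a::real_normed_vector \<Rightarrow> 'a) \<Rightarrow> 'a set \<Rightarrow> 'a \<Rightarrow> real \<Rightarrow> 'a set" where
  "stable_set f N z0 t1 =
     {z. (\<forall>t\<ge>0. phi f (t1 + t) t1 z \<in> Some ` N) \<and>
         ((\<lambda>t. the (phi f t t1 z)) \<longlongrightarrow> z0) at_top}"

definition block :: "real ^ 'u::finite \<Rightarrow> real \<Rightarrow> real ^ 's::finite \<Rightarrow> real \<Rightarrow> (real ^ ('u + 's)) set" where
  "block px rx py ry = {join x y | x y. x \<in> cball px rx \<and> y \<in> cball py ry}"

definition exit_set :: "real ^ 'u::finite \<Rightarrow> real \<Rightarrow> real ^ 's::finite \<Rightarrow> real \<Rightarrow> (real ^ ('u + 's)) set" where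
  "exit_set px rx py ry = {join x y | x y. x \<in> frontier (cball px rx) \<and> y \<in> cball py ry}"

definition entrance_set :: "real ^ 'u::finite \<Rightarrow> real \<Rightarrow> real ^ 's::finite \<Rightarrow> real \<Rightarrow> (real ^ ('u + 's)) set" where
  "entrance_set px rx py ry = {join x y | x y. x \<in> cball px rx \<and> y \<in> frontier (cball py ry)}"

definition eta_section ::
  "(real \<Rightarrow> 'a::real_normed_vector \<Rightarrow> 'a option) \<Rightarrow> real \<Rightarrow> 'a set \<Rightarrow> bool" where
  "eta_section \<psi> \<eta> \<Sigma> \<longleftrightarrow>
     (\<forall>x\<in>\<Sigma>. \<forall>t\<in>{-\<eta><..<\<eta>}. \<psi> t x \<noteq> None) \<and>
     (let F = (\<lambda>(x, t). the (\<psi> t x)); D = \<Sigma> \<times> {-\<eta><..<\<eta>}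
      in open (F ` D) \<and> (\<exists>G. homeomorphism D (F ` D) F G))"

text \<open>
  In the exit and entrance conditions a trajectory that has ceased to exist counts as being
  outside the block.
\<close>

definition isolating_block ::
  "(real \<Rightarrow> real ^ ('u::finite + 's::finite) \<Rightarrow> real ^ ('u + 's)) \<Rightarrow>
   real ^ 'u::finite \<Rightarrow> real \<Rightarrow> real ^ 's::finite \<Rightarrow> real \<Rightarrow> real set \<Rightarrow> bool" where
  "isolating_block f px rx py ry T \<longleftrightarrow>
     (\<exists>\<eta>>0. \<exists>\<Sigma>m \<Sigma>p.
        exit_set px rx py ry \<subseteq> \<Sigma>m \<and> entrance_set px rx py ry \<subseteq> \<Sigma>p \<and>
        (\<forall>t1\<in>T.
           eta_section (local_flow (f t1)) \<eta> \<Sigma>m \<and> eta_section (local_flow (f t1)) \<eta> \<Sigma>p \<and>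
           (\<forall>x\<in>entrance_set px rx py ry. \<forall>t\<in>{-\<eta><..<0}.
              phi f (t1 + t) t1 x \<notin> Some ` block px rx py ry) \<and>
           (\<forall>x\<in>exit_set px rx py ry. \<forall>t\<in>{0<..<\<eta>}.
              phi f (t1 + t) t1 x \<notin> Some ` block px rx py ry)))"

definition Qmat :: "real \<Rightarrow> real \<Rightarrow> real ^ ('u::finite + 's::finite) ^ ('u + 's)" where
  "Qmat a b = (\<chi> i j. if i = j then (case i of Inl _ \<Rightarrow> a | Inr _ \<Rightarrow> - b) else 0)"

lemma transpose_Qmat: "transpose (Qmat a b) = Qmat a b"
  by (auto simp: Qmat_def transpose_def vec_eq_iff)

lemma Qmat_quadratic_form:
  fixes x :: "real ^ 'u::finite" and y :: "real ^ 's::finite"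
  shows "join x y \<bullet> (Qmat a b *v join x y) = a * (norm x)\<^sup>2 - b * (norm y)\<^sup>2"
proof -
  have "(Qmat a b *v join x y) $ k = (case k of Inl i \<Rightarrow> a * x $ i | Inr j \<Rightarrow> - b * y $ j)" for k
    by (auto simp: Qmat_def join_def matrix_vector_mult_def if_distrib[of "\<lambda>c. c * _"]
        cong: if_cong split: sum.split)
  then have "join x y \<bullet> (Qmat a b *v join x y) =
      (\<Sum>k\<in>UNIV <+> UNIV. case k of Inl i \<Rightarrow> a * (x $ i)\<^sup>2 | Inr j \<Rightarrow> - b * (y $ j)\<^sup>2)"
    unfolding inner_vec_def UNIV_Plus_UNIV
    by (intro sum.cong) (auto simp: join_def power2_eq_square split: sum.split)
  also have "\<dots> = a * (\<Sum>i\<in>UNIV. (x $ i)\<^sup>2) - b * (\<Sum>j\<in>UNIV. (y $ j)\<^sup>2)"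
    by (subst sum.Plus) (simp_all add: sum_distrib_left sum_negf)
  also have "\<dots> = a * (norm x)\<^sup>2 - b * (norm y)\<^sup>2"
    by (simp only: power2_norm_eq_inner) (simp add: inner_vec_def power2_eq_square)
  finally show ?thesis .
qed

definition lie :: "real ^ 'n ^ 'n \<Rightarrow> real ^ 'n ^ 'n \<Rightarrow> real ^ 'n ^ 'n" where
  "lie Q A = transpose A ** Q + Q ** A"

definition pos_def_mat :: "real ^ 'n ^ 'n \<Rightarrow> bool" where
  "pos_def_mat M \<longleftrightarrow> transpose M = M \<and> (\<forall>v. v \<noteq> 0 \<longrightarrow> v \<bullet> (M *v v) > 0)"

definition interval_jacobian ::
  "(real \<Rightarrow> real ^ 'n \<Rightarrow> real ^ 'n) \<Rightarrow> (real ^ 'n) set \<Rightarrow> real \<Rightarrow> (real ^ 'n ^ 'n) set" where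
  "interval_jacobian f N t =
     {A. \<forall>i j. A $ i $ j \<in> {(INF z\<in>N. pd_z f t z $ i $ j) .. (SUP z\<in>N. pd_z f t z $ i $ j)}}"

text \<open>
  The condition is pointwise in \<open>t\<close>: it yields a lower bound \<open>E * (norm v)\<^sup>2\<close> with \<open>E > 0\<close>
  uniformly on compact time intervals, but not on all of \<open>t \<ge> t0\<close>, as
  \<open>f t (x, y) = exp (- t) (x, - y)\<close> shows.
\<close>

definition cone_condition ::
  "(real \<Rightarrow> real ^ 'n \<Rightarrow> real ^ 'n) \<Rightarrow> (real ^ 'n) set \<Rightarrow> real ^ 'n ^ 'n \<Rightarrow> real \<Rightarrow> bool" where
  "cone_condition f N Q t0 \<longleftrightarrow>
     (\<forall>t\<ge>t0. \<forall>A\<in>interval_jacobian f N t. pos_def_mat (lie Q A))"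

definition bilin_norm ::
  "('a::real_normed_vector \<Rightarrow> 'b::real_normed_vector \<Rightarrow> real) \<Rightarrow> real" where
  "bilin_norm M = (SUP (v, w)\<in>cball 0 1 \<times> cball 0 1. \<bar>M v w\<bar>)"

text \<open>The bilinear map on \<open>\<real> \<times> \<real>\<^sup>n\<close> induced by a vector \<open>d\<close>, read as \<open>d\<^sup>T Q + Q d\<close>.\<close>

definition lie_vec :: "real ^ 'n ^ 'n \<Rightarrow> real ^ 'n \<Rightarrow> real \<Rightarrow> real ^ 'n \<Rightarrow> real" where
  "lie_vec Q d \<tau> v = \<tau> * (d \<bullet> (Q *v v)) + (v \<bullet> (Q *v d)) * \<tau>"

text \<open>
  No boundedness of the time derivative is assumed, so the supremum is taken in the extended
  reals; note that \<open>\<infinity> * 0 = 0\<close> there.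
\<close>

definition m_const ::
  "(real \<Rightarrow> real ^ 'n \<Rightarrow> real ^ 'n) \<Rightarrow> (real ^ 'n) set \<Rightarrow> real ^ 'n ^ 'n \<Rightarrow> real \<Rightarrow> ereal" where
  "m_const f N Q t0 = (SUP (t, z)\<in>{t0..} \<times> N. ereal (bilin_norm (lie_vec Q (pd_t f t z))))"

end

theory Submission
  imports Defs
begin

text \<open>
  Two trajectories starting in the stable sets at times \<open>t1\<close> and \<open>t2\<close> are compared after shifting
  time, i.e. \<open>w s\<close> is the difference of their values at times \<open>t1 + s\<close> and \<open>t2 + s\<close>. The cone
  condition and the mean value theorem in \<open>z\<close> and in \<open>t\<close> give
  \<open>(Q w)' \<ge> E |w|\<^sup>2 - m |t1 - t2| |w| \<ge> E / (2 a) * (Q w - a m\<^sup>2 / E\<^sup>2 (t1 - t2)\<^sup>2)\<close>.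
  If the claim fails, the last bracket is positive at \<open>s = 0\<close>, so by Gronwall it never decreases below
  this value; but \<open>w s\<close> tends to \<open>0\<close> because both trajectories tend to \<open>z0\<close>.
\<close>

section \<open>A Gronwall inequality and calculus for C1 right-hand sides\<close>

text \<open>The integrating factor \<open>exp (- k * s)\<close> turns the differential inequality
  into monotonicity of \<open>G\<close>. It serves twice: for uniqueness of solutions, with
  \<open>h\<close> minus a squared distance, and for the growth of the quadratic form along a
  difference of trajectories.\<close>

lemma gronwall_lower_bound:
  fixes h h' :: "real \<Rightarrow> real"
  assumes "c \<le> d"
    and deriv: "\<And>s. s \<in> {c..d} \<Longrightarrow> (h has_real_derivative h' s) (at s within {c..d})"
    and le: "\<And>s. s \<in> {c..d} \<Longrightarrow> k * h s \<le> h' s"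
  shows "exp (k * (d - c)) * h c \<le> h d"
proof (cases "c = d")
  case False
  define G where "G s = exp (- k * s) * h s" for s
  have "\<exists>\<xi>\<in>{c<..<d}. G d - G c = exp (- k * \<xi>) * (h' \<xi> - k * h \<xi>) * (d - c)"
  proof (rule mvt_simple[where f' = "\<lambda>s. (*) (exp (- k * s) * (h' s - k * h s))"])
    show "c < d" using False assms(1) by simp
    fix s assume "c \<le> s" "s \<le> d"
    then have "(G has_real_derivative exp (- k * s) * (h' s - k * h s)) (at s within {c..d})"
      unfolding G_def
      by (auto intro!: derivative_eq_intros deriv simp: algebra_simps)
    then show "(G has_derivative (*) (exp (- k * s) * (h' s - k * h s))) (at s within {c..d})"
      by (simp add: has_field_derivative_def)
  qed
  then obtain \<xi> where "\<xi> \<in> {c<..<d}"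
    and \<xi>: "G d - G c = exp (- k * \<xi>) * (h' \<xi> - k * h \<xi>) * (d - c)"
    by blast
  moreover from this have "0 \<le> exp (- k * \<xi>) * (h' \<xi> - k * h \<xi>) * (d - c)"
    using le[of \<xi>] by (intro mult_nonneg_nonneg) auto
  ultimately have "G c \<le> G d" by simp
  then have "exp (k * d) * (exp (- k * c) * h c) \<le> exp (k * d) * (exp (- k * d) * h d)"
    by (simp add: G_def)
  moreover have "exp (k * d) * exp (- k * c) = exp (k * (d - c))" "exp (k * d) * exp (- k * d) = 1"
    by (simp_all add: mult_exp_exp right_diff_distrib)
  ultimately show ?thesis
    by (metis mult.assoc mult_1)
qed simp

lemma has_derivative_partial_space:
  assumes "((\<lambda>(t, z). f t z) has_derivative D) (at (t, z))"
  shows "(f t has_derivative (\<lambda>v. D (0, v))) (at z)"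
proof -
  have "((\<lambda>z. (t, z)) has_derivative (\<lambda>v. (0, v))) (at z)"
    by (intro has_derivative_Pair has_derivative_const has_derivative_ident)
  from has_derivative_compose[OF this assms] show ?thesis by simp
qed

lemma has_vector_derivative_partial_time:
  assumes "((\<lambda>(t, z). f t z) has_derivative D) (at (t, z))"
  shows "((\<lambda>\<tau>. f \<tau> z) has_vector_derivative D (1, 0)) (at t)"
proof -
  have "((\<lambda>\<tau>. f \<tau> z) has_derivative (\<lambda>h. D (h, 0))) (at t)"
  proof -
    have "((\<lambda>t. (t, z)) has_derivative (\<lambda>h. (h, 0))) (at t)"
      by (intro has_derivative_Pair has_derivative_const has_derivative_ident)
    from has_derivative_compose[OF this assms] show ?thesis by simp
  qed
  moreover have "(\<lambda>h. D (h, 0)) = (\<lambda>h. h *\<^sub>R D (1, 0))"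
  proof
    show "D (h, 0) = h *\<^sub>R D (1, 0)" for h
      using linear_cmul[OF has_derivative_linear[OF assms], of h "(1, 0)"] by simp
  qed
  ultimately show ?thesis by (simp only: has_vector_derivative_def)
qed

text \<open>The continuous total derivative is bounded on the compact set
  \<open>I \<times> K\<close>. Convexity of \<open>K\<close> then permits the mean value inequality
  in space, with one constant for all times in \<open>I\<close>.\<close>

lemma lipschitz_on_compact:
  fixes f :: "real \<Rightarrow> 'a::euclidean_space \<Rightarrow> 'b::real_normed_vector"
  assumes "C1 (\<lambda>(t, z). f t z)" "compact I" "compact K" "convex K"
  obtains L where "\<And>t x y. t \<in> I \<Longrightarrow> x \<in> K \<Longrightarrow> y \<in> K \<Longrightarrow> norm (f t x - f t y) \<le> L * norm (x - y)"
proof -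
  obtain f' :: "real \<times> 'a \<Rightarrow> (real \<times> 'a) \<Rightarrow>\<^sub>L 'b"
    where f': "\<And>p. ((\<lambda>(t, z). f t z) has_derivative blinfun_apply (f' p)) (at p)"
      and cont: "continuous_on UNIV f'"
    using assms(1) unfolding C1_def by blast
  have "bounded (f' ` (I \<times> K))"
    by (intro compact_imp_bounded compact_continuous_image compact_Times assms
        continuous_on_subset[OF cont]) simp
  then obtain L where L: "\<And>p. p \<in> I \<times> K \<Longrightarrow> norm (f' p) \<le> L"
    by (auto simp: bounded_iff)
  have "norm (f t x - f t y) \<le> L * norm (x - y)" if "t \<in> I" "x \<in> K" "y \<in> K" for t x y
  proof (rule differentiable_bound[OF \<open>convex K\<close> _ _ \<open>x \<in> K\<close> \<open>y \<in> K\<close>])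
    fix z assume "z \<in> K"
    show "(f t has_derivative (\<lambda>v. blinfun_apply (f' (t, z)) (0, v))) (at z within K)"
      by (rule has_derivative_at_withinI[OF has_derivative_partial_space[OF f']])
    show "onorm (\<lambda>v. blinfun_apply (f' (t, z)) (0, v)) \<le> L"
    proof (rule onorm_le)
      fix v :: 'a
      have "norm (blinfun_apply (f' (t, z)) (0, v)) \<le> norm (f' (t, z)) * norm (0::real, v)"
        by (rule norm_blinfun)
      also have "\<dots> \<le> L * norm v"
        using L[of "(t, z)"] \<open>z \<in> K\<close> \<open>t \<in> I\<close> by (simp add: norm_Pair mult_right_mono)
      finally show "norm (blinfun_apply (f' (t, z)) (0, v)) \<le> L * norm v" .
    qed
  qed
  then show ?thesis using that by blast
qed

text \<open>Symmetry of \<open>B\<close> makes the two terms of the product rule equal, hence the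
  factor 2.\<close>

lemma has_real_derivative_quadratic_form:
  fixes w :: "real \<Rightarrow> 'a::real_inner"
  assumes "bounded_linear B" and sym: "\<And>x y. x \<bullet> B y = B x \<bullet> y"
    and w: "(w has_vector_derivative w') (at s within S)"
  shows "((\<lambda>s. w s \<bullet> B (w s)) has_real_derivative 2 * (w s \<bullet> B w')) (at s within S)"
proof -
  note Bw = bounded_linear.has_vector_derivative[OF assms(1) w]
  have "((\<lambda>s. w s \<bullet> B (w s)) has_vector_derivative w s \<bullet> B w' + w' \<bullet> B (w s)) (at s within S)"
    by (rule bounded_bilinear.has_vector_derivative[OF bounded_bilinear_inner w Bw])
  moreover have "w' \<bullet> B (w s) = w s \<bullet> B w'"
    by (metis sym inner_commute)
  ultimately show ?thesis
    by (simp add: has_real_derivative_iff_has_vector_derivative)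
qed

section \<open>Uniqueness of solutions and trajectories in the stable set\<close>

text \<open>Both solution curves over \<open>{c..d}\<close> lie in one closed ball, on which
  \<open>f\<close> is Lipschitz in space. Their squared distance vanishes at \<open>c\<close>, so by
  Gronwall it vanishes at \<open>d\<close>.\<close>

lemma connects_unique:
  fixes f :: "real \<Rightarrow> 'a::euclidean_space \<Rightarrow> 'a"
  assumes f: "C1 (\<lambda>(t, z). f t z)" and "c \<le> d"
    and "connects f c p d q1" "connects f c p d q2"
  shows "q1 = q2"
proof -
  obtain u v where u: "u c = p" "u d = q1" "v c = p" "v d = q2"
    and du: "\<And>\<tau>. \<tau> \<in> {c..d} \<Longrightarrow> (u has_vector_derivative f \<tau> (u \<tau>)) (at \<tau> within {c..d})"
    and dv: "\<And>\<tau>. \<tau> \<in> {c..d} \<Longrightarrow> (v has_vector_derivative f \<tau> (v \<tau>)) (at \<tau> within {c..d})"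
    using assms(2-4) unfolding connects_def closed_segment_eq_real_ivl by auto
  have "continuous_on {c..d} u" "continuous_on {c..d} v"
    using du dv has_vector_derivative_continuous continuous_on_eq_continuous_within by blast+
  then have "bounded (u ` {c..d} \<union> v ` {c..d})"
    by (simp add: compact_imp_bounded compact_continuous_image)
  then obtain R where R: "\<And>x. x \<in> u ` {c..d} \<union> v ` {c..d} \<Longrightarrow> norm x \<le> R"
    unfolding bounded_iff by blast
  obtain L where
    L: "\<And>t x y. t \<in> {c..d} \<Longrightarrow> x \<in> cball 0 R \<Longrightarrow> y \<in> cball 0 R \<Longrightarrow> norm (f t x - f t y) \<le> L * norm (x - y)"
    using lipschitz_on_compact[OF f compact_Icc compact_cball convex_cball] by blast
  \<comment> \<open>The sign is reversed because the Gronwall lemma gives lower bounds: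
    \<open>0 \<le> h d\<close> forces the distance to be 0.\<close>
  define h where "h s = - ((u s - v s) \<bullet> (u s - v s))" for s
  have "exp (2 * L * (d - c)) * h c \<le> h d"
  proof (rule gronwall_lower_bound[OF \<open>c \<le> d\<close>,
        where h' = "\<lambda>s. - 2 * ((u s - v s) \<bullet> (f s (u s) - f s (v s)))"])
    fix s assume s: "s \<in> {c..d}"
    show "(h has_real_derivative - 2 * ((u s - v s) \<bullet> (f s (u s) - f s (v s)))) (at s within {c..d})"
      using DERIV_minus[OF has_real_derivative_quadratic_form[OF bounded_linear_ident refl
            has_vector_derivative_diff[OF du[OF s] dv[OF s]]]]
      by (simp add: h_def[abs_def])
    have "(u s - v s) \<bullet> (f s (u s) - f s (v s)) \<le> norm (u s - v s) * norm (f s (u s) - f s (v s))"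
      by (rule norm_cauchy_schwarz)
    also have "\<dots> \<le> norm (u s - v s) * (L * norm (u s - v s))"
      by (intro mult_left_mono L s) (use R[of "u s"] R[of "v s"] s in auto)
    finally show "2 * L * h s \<le> - 2 * ((u s - v s) \<bullet> (f s (u s) - f s (v s)))"
      by (simp add: h_def dot_square_norm power2_eq_square algebra_simps)
  qed
  then show ?thesis using u by (simp add: h_def dot_square_norm)
qed

lemma phi_eq_Some:
  fixes f :: "real \<Rightarrow> 'a::euclidean_space \<Rightarrow> 'a"
  assumes "C1 (\<lambda>(t, z). f t z)" "c \<le> d" "connects f c p d q"
  shows "phi f d c p = Some q"
proof -
  have "(THE q. connects f c p d q) = q"
    using assms connects_unique by blast
  then show ?thesis using assms(3) unfolding phi_def by auto
qed

text \<open>Membership in the stable set speaks only of single values of \<open>phi\<close>. Here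
  they are assembled into one differentiable curve on \<open>{0..S}\<close>, with time counted from
  the starting time so that curves starting at different times become comparable.\<close>

lemma stable_set_trajectory:
  fixes f :: "real \<Rightarrow> 'a::euclidean_space \<Rightarrow> 'a"
  assumes f: "C1 (\<lambda>(t, z). f t z)" and z: "z \<in> stable_set f N z0 c" and "0 \<le> S"
  shows "\<exists>u. u 0 = z \<and> u S = the (phi f (c + S) c z) \<and> (\<forall>s\<in>{0..S}. u s \<in> N \<and>
    (u has_vector_derivative f (c + s) (u s)) (at s within {0..S}))"
proof -
  have N: "phi f (c + t) c z \<in> Some ` N" if "t \<ge> 0" for t
    using z that by (simp add: stable_set_def)
  have "\<exists>q. connects f c z (c + S) q"
    using N[OF \<open>0 \<le> S\<close>] unfolding phi_def by (auto split: if_splits)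
  then obtain q where "connects f c z (c + S) q" by blast
  then obtain w where w: "w c = z" "w (c + S) = q"
    and dw: "\<And>\<tau>. \<tau> \<in> {c..c + S} \<Longrightarrow> (w has_vector_derivative f \<tau> (w \<tau>)) (at \<tau> within {c..c + S})"
    using \<open>0 \<le> S\<close> unfolding connects_def closed_segment_eq_real_ivl by auto
  \<comment> \<open>The solution reaching time \<open>c + S\<close>, restricted to
    \<open>{c..c + s}\<close>, also reaches time \<open>c + s\<close>. By uniqueness it gives all
    intermediate values of \<open>phi\<close>.\<close>
  have phi: "phi f (c + s) c z = Some (w (c + s))" if "s \<in> {0..S}" for s
  proof (rule phi_eq_Some[OF f])
    show "connects f c z (c + s) (w (c + s))"
      unfolding connects_def using that w
      by (intro exI[of _ w])
        (auto simp: closed_segment_eq_real_ivl intro!: has_vector_derivative_within_subset[OF dw])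
  qed (use that in simp)
  have "w (c + s) \<in> N" if "s \<in> {0..S}" for s
    using phi[OF that] N[of s] that by auto
  moreover have "((\<lambda>s. w (c + s)) has_vector_derivative f (c + s) (w (c + s))) (at s within {0..S})"
    if s: "s \<in> {0..S}" for s
  proof -
    have "(w has_vector_derivative f (c + s) (w (c + s))) (at (c + s) within (\<lambda>s. c + s) ` {0..S})"
      using dw[of "c + s"] s by (simp add: image_add_atLeastAtMost add.commute)
    then have "((w \<circ> (\<lambda>s. c + s)) has_vector_derivative 1 *\<^sub>R f (c + s) (w (c + s))) (at s within {0..S})"
      by (intro vector_diff_chain_within) (auto intro!: derivative_eq_intros)
    then show ?thesis by (simp add: o_def)
  qed
  ultimately show ?thesis
    using w phi[of S] \<open>0 \<le> S\<close> by (intro exI[of _ "\<lambda>s. w (c + s)"]) auto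
qed

section \<open>Partial derivatives of the vector field\<close>

lemma pd_z_eq:
  assumes "(f t has_derivative f') (at z)"
  shows "pd_z f t z *v v = f' v"
proof -
  have "(f t has_derivative (\<lambda>v. pd_z f t z *v v)) (at z)"
    using assms jacobian_works unfolding pd_z_def differentiable_def by blast
  then show ?thesis using assms has_derivative_unique by metis
qed

lemma C1_has_derivative_pd_z:
  assumes "C1 (\<lambda>(t, z). f t z)"
  shows "(f t has_derivative (\<lambda>v. pd_z f t z *v v)) (at z)"
proof -
  obtain D where "((\<lambda>(t, z). f t z) has_derivative D) (at (t, z))"
    using assms unfolding C1_def by blast
  then have "f t differentiable at z"
    unfolding differentiable_def using has_derivative_partial_space by blast
  then show ?thesis unfolding pd_z_def by (simp add: jacobian_works)
qed

lemma C1_has_vector_derivative_pd_t: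
  assumes "C1 (\<lambda>(t, z). f t z)"
  shows "((\<lambda>\<tau>. f \<tau> z) has_vector_derivative pd_t f t z) (at t)"
proof -
  obtain D where "((\<lambda>(t, z). f t z) has_derivative D) (at (t, z))"
    using assms unfolding C1_def by blast
  from has_vector_derivative_partial_time[OF this] show ?thesis
    unfolding pd_t_def by (simp add: vector_derivative_at)
qed

text \<open>Column \<open>j\<close> of the Jacobian is the total derivative applied to
  \<open>(0, axis j 1)\<close>, so its entries inherit joint continuity in time and space.\<close>

lemma C1_continuous_pd_z:
  fixes f :: "real \<Rightarrow> real ^ 'n \<Rightarrow> real ^ 'n"
  assumes "C1 (\<lambda>(t, z). f t z)"
  shows "continuous_on UNIV (\<lambda>(t, z). pd_z f t z)"
proof -
  obtain f' :: "real \<times> (real ^ 'n) \<Rightarrow> (real \<times> (real ^ 'n)) \<Rightarrow>\<^sub>L (real ^ 'n)"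
    where f': "\<And>p. ((\<lambda>(t, z). f t z) has_derivative blinfun_apply (f' p)) (at p)"
      and cont: "continuous_on UNIV f'"
    using assms unfolding C1_def by blast
  have "pd_z f t z $ i $ j = blinfun_apply (f' (t, z)) (0, axis j 1) $ i" for t z i j
  proof -
    have "(f t has_derivative (\<lambda>v. blinfun_apply (f' (t, z)) (0, v))) (at z)"
      by (rule has_derivative_partial_space[OF f'])
    from pd_z_eq[where f = f and t = t and z = z and f' = "\<lambda>v. blinfun_apply (f' (t, z)) (0, v)", OF this, of "axis j 1"]
    show ?thesis by (metis column_def matrix_vector_mult_basis vec_lambda_beta)
  qed
  then have "(\<lambda>(t, z). pd_z f t z) = (\<lambda>p. \<chi> i j. blinfun_apply (f' p) (0, axis j 1) $ i)"
    by (auto simp: vec_eq_iff)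
  then show ?thesis
    by (auto intro!: continuous_intros cont)
qed

section \<open>Linear algebra of the quadratic form and of the bilinear norm\<close>

lemma symmetric_matrix_inner:
  fixes Q :: "real ^ 'n ^ 'n"
  assumes "transpose Q = Q"
  shows "x \<bullet> (Q *v y) = (Q *v x) \<bullet> y"
proof -
  have "x v* Q = Q *v x"
    using vector_transpose_matrix[of x Q] assms by simp
  then show ?thesis
    using dot_lmul_matrix[of x Q y] by simp
qed

text \<open>For symmetric \<open>Q\<close> the two summands of \<open>lie Q A\<close> are transposes
  of each other and have the same quadratic form. The value is the derivative of the form
  \<open>Q\<close> along \<open>v' = A v\<close>.\<close>

lemma lie_quadratic_form:
  fixes Q :: "real ^ 'n ^ 'n"
  assumes "transpose Q = Q"
  shows "v \<bullet> (lie Q A *v v) = 2 * (v \<bullet> (Q *v (A *v v)))"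
proof -
  have "v \<bullet> (transpose A *v (Q *v v)) = (A *v v) \<bullet> (Q *v v)"
    by (metis dot_lmul_matrix inner_commute transpose_matrix_vector)
  also have "\<dots> = v \<bullet> (Q *v (A *v v))"
    using symmetric_matrix_inner[OF assms] by (metis inner_commute)
  finally show ?thesis
    by (simp add: lie_def matrix_vector_mult_add_rdistrib matrix_vector_mul_assoc[symmetric]
        inner_add_right)
qed

text \<open>A real supremum dominates its members only if the set is bounded above; continuity on a
  product of compact balls ensures this.\<close>

lemma abs_lie_vec_le_bilin_norm:
  fixes Q :: "real ^ 'n ^ 'n"
  assumes "\<bar>\<tau>\<bar> \<le> 1" "norm v \<le> 1"
  shows "\<bar>lie_vec Q d \<tau> v\<bar> \<le> bilin_norm (lie_vec Q d)"
proof -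
  have "continuous_on (cball 0 1 \<times> cball 0 1) (\<lambda>(\<tau>, v). \<bar>lie_vec Q d \<tau> v\<bar>)"
    unfolding lie_vec_def split_def
    by (intro continuous_intros continuous_on_compose2[OF matrix_vector_mult_linear_continuous_on]) auto
  then have "bounded ((\<lambda>(\<tau>, v). \<bar>lie_vec Q d \<tau> v\<bar>) ` (cball 0 1 \<times> cball 0 1))"
    by (intro compact_imp_bounded compact_continuous_image compact_Times) auto
  then have "bdd_above ((\<lambda>(\<tau>, v). \<bar>lie_vec Q d \<tau> v\<bar>) ` (cball 0 1 \<times> cball 0 1))"
    by (rule bounded_imp_bdd_above)
  from cSUP_upper[OF _ this, of "(\<tau>, v)"] show ?thesis
    using assms unfolding bilin_norm_def by simp
qed

text \<open>The bilinear map is tested at \<open>1\<close> and the unit vector along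
  \<open>v\<close>, where its two terms coincide.\<close>

lemma inner_le_bilin_norm_lie_vec:
  fixes Q :: "real ^ 'n ^ 'n"
  assumes "transpose Q = Q"
  shows "2 * \<bar>v \<bullet> (Q *v d)\<bar> \<le> bilin_norm (lie_vec Q d) * norm v"
proof (cases "v = 0")
  case False
  have "lie_vec Q d 1 (v /\<^sub>R norm v) = 2 * (v \<bullet> (Q *v d)) / norm v"
    using symmetric_matrix_inner[OF assms, of d v]
    by (simp add: lie_vec_def matrix_vector_mult_scaleR inner_commute field_simps)
  then have "2 * \<bar>v \<bullet> (Q *v d)\<bar> / norm v \<le> bilin_norm (lie_vec Q d)"
    using abs_lie_vec_le_bilin_norm[of 1 "v /\<^sub>R norm v" Q d] False by (simp add: abs_mult)
  then show ?thesis using False by (simp add: field_simps)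
qed simp

section \<open>Increments of the vector field in space and in time\<close>

text \<open>Pairing with the fixed vector \<open>x - y\<close> yields a scalar function on the
  segment, so the mean value theorem gives an equality at a single point. Convexity keeps that point
  in \<open>N\<close>, where the cone bound applies.\<close>

lemma cone_lower_bound_increment:
  fixes f :: "real \<Rightarrow> real ^ 'n \<Rightarrow> real ^ 'n"
  assumes f: "C1 (\<lambda>(t, z). f t z)" and "convex N" and Q: "transpose Q = Q"
    and cone: "\<And>z v. z \<in> N \<Longrightarrow> E * (norm v)\<^sup>2 \<le> v \<bullet> (lie Q (pd_z f t z) *v v)"
    and "x \<in> N" "y \<in> N"
  shows "E * (norm (x - y))\<^sup>2 \<le> 2 * ((x - y) \<bullet> (Q *v (f t x - f t y)))"
proof -
  let ?w = "x - y"
  define p where "p \<theta> = ?w \<bullet> (Q *v f t (y + \<theta> *\<^sub>R ?w))" for \<theta>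
  have "(p has_derivative (\<lambda>h. ?w \<bullet> (Q *v (pd_z f t (y + \<theta> *\<^sub>R ?w) *v (h *\<^sub>R ?w)))))
      (at \<theta> within {0..1})" for \<theta>
  proof -
    have "((\<lambda>\<theta>. f t (y + \<theta> *\<^sub>R ?w)) has_derivative
        (\<lambda>h. pd_z f t (y + \<theta> *\<^sub>R ?w) *v (h *\<^sub>R ?w))) (at \<theta> within {0..1})"
      by (rule has_derivative_compose[OF _ C1_has_derivative_pd_z[OF f]])
        (auto intro!: derivative_eq_intros)
    from bounded_linear.has_derivative[OF matrix_vector_mul_bounded_linear this]
    show ?thesis
      unfolding p_def by (rule has_derivative_inner_right)
  qed
  then obtain \<theta> where \<theta>: "\<theta> \<in> {0<..<1}"
    and eq: "p 1 - p 0 = ?w \<bullet> (Q *v (pd_z f t (y + \<theta> *\<^sub>R ?w) *v ((1 - 0) *\<^sub>R ?w)))"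
    using mvt_simple[of 0 1 p] by (metis (no_types, lifting) zero_less_one)
  have "y + \<theta> *\<^sub>R ?w = (1 - \<theta>) *\<^sub>R y + \<theta> *\<^sub>R x"
    by (simp add: algebra_simps)
  then have "y + \<theta> *\<^sub>R ?w \<in> N"
    using \<theta> assms(2,5,6) by (auto simp: convex_def)
  from cone[OF this, of ?w] have "E * (norm ?w)\<^sup>2 \<le> 2 * (p 1 - p 0)"
    by (simp only: lie_quadratic_form[OF Q] eq diff_zero scaleR_one)
  then show ?thesis
    by (simp add: p_def matrix_vector_mult_diff_distrib inner_diff_right)
qed

lemma time_increment_bound:
  fixes f :: "real \<Rightarrow> real ^ 'n \<Rightarrow> real ^ 'n"
  assumes f: "C1 (\<lambda>(t, z). f t z)"
    and bound: "\<And>t. t \<ge> t0 \<Longrightarrow> \<bar>v \<bullet> (Q *v pd_t f t z)\<bar> \<le> C"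
    and "s1 \<ge> t0" "s2 \<ge> t0"
  shows "\<bar>v \<bullet> (Q *v (f s1 z - f s2 z))\<bar> \<le> C * \<bar>s1 - s2\<bar>"
proof -
  have "((\<lambda>\<tau>. v \<bullet> (Q *v f \<tau> z)) has_real_derivative v \<bullet> (Q *v pd_t f t z)) (at t within {t0..})" for t
    unfolding has_real_derivative_iff_has_vector_derivative
    by (rule bounded_linear.has_vector_derivative[OF bounded_linear_inner_right
          bounded_linear.has_vector_derivative[OF matrix_vector_mul_bounded_linear
            has_vector_derivative_at_within[OF C1_has_vector_derivative_pd_t[OF f]]]])
  from field_differentiable_bound[OF convex_real_interval(1) this, of C s1 s2]
  show ?thesis
    using assms(2-4) by (simp add: matrix_vector_mult_diff_distrib inner_diff_right)
qed

section \<open>Comparison of two trajectories in stable sets\<close>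

text \<open>\<open>D\<close> stands for \<open>m * \<bar>t1 - t2\<bar>\<close>. Keeping it abstract
  lets \<open>D = 0\<close> cover equal starting times even when \<open>m\<close> is
  infinite.\<close>

lemma stable_set_form_bound:
  fixes f :: "real \<Rightarrow> real ^ 'n \<Rightarrow> real ^ 'n"
  assumes f: "C1 (\<lambda>(t, z). f t z)" and "convex N" and Q: "transpose Q = Q"
    and "a > 0" and form_le: "\<And>v. v \<bullet> (Q *v v) \<le> a * (norm v)\<^sup>2"
    and "E > 0"
    and cone: "\<And>t z v. t \<ge> t0 \<Longrightarrow> z \<in> N \<Longrightarrow> E * (norm v)\<^sup>2 \<le> v \<bullet> (lie Q (pd_z f t z) *v v)"
    and time: "\<And>s z v. s \<ge> 0 \<Longrightarrow> z \<in> N \<Longrightarrow>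
      2 * \<bar>v \<bullet> (Q *v (f (t1 + s) z - f (t2 + s) z))\<bar> \<le> D * norm v"
    and "t1 \<ge> t0" and p1: "p1 \<in> stable_set f N z0 t1"
    and p2: "p2 \<in> stable_set f N z0 t2"
  shows "(p1 - p2) \<bullet> (Q *v (p1 - p2)) \<le> a * D\<^sup>2 / E\<^sup>2"
proof (rule ccontr)
  \<comment> \<open>The offset is chosen so that \<open>E / (2 * a)\<close> times it equals
    \<open>D\<^sup>2 / (2 * E)\<close>, the remainder that AM-GM leaves below.\<close>
  define H where "H w = w \<bullet> (Q *v w) - a * D\<^sup>2 / E\<^sup>2" for w
  assume "\<not> ?thesis"
  then have pos: "H (p1 - p2) > 0" by (simp add: H_def)
  define q where "q S = the (phi f (t1 + S) t1 p1) - the (phi f (t2 + S) t2 p2)" for S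
  \<comment> \<open>To be used with \<alpha>, \<beta>, \<gamma> the pairings of the difference with
    \<open>Q\<close> applied to \<open>f (t1 + s) (u s)\<close>, \<open>f (t1 + s) (v s)\<close> and
    \<open>f (t2 + s) (v s)\<close>: first the point changes, then the time.\<close>
  have arith: "e - d \<le> 2 * (\<alpha> - \<gamma>)" if "e \<le> 2 * (\<alpha> - \<beta>)" "2 * \<bar>\<beta> - \<gamma>\<bar> \<le> d"
    for e d \<alpha> \<beta> \<gamma> :: real
    using that by argo
  have growth: "H (p1 - p2) \<le> H (q S)" if S: "S \<ge> 0" for S
  proof -
    obtain u where u: "u 0 = p1" "u S = the (phi f (t1 + S) t1 p1)"
      and uN: "\<And>s. s \<in> {0..S} \<Longrightarrow> u s \<in> N"
      and du: "\<And>s. s \<in> {0..S} \<Longrightarrow> (u has_vector_derivative f (t1 + s) (u s)) (at s within {0..S})"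
      using stable_set_trajectory[OF f p1 S] by auto
    obtain v where v: "v 0 = p2" "v S = the (phi f (t2 + S) t2 p2)"
      and vN: "\<And>s. s \<in> {0..S} \<Longrightarrow> v s \<in> N"
      and dv: "\<And>s. s \<in> {0..S} \<Longrightarrow> (v has_vector_derivative f (t2 + s) (v s)) (at s within {0..S})"
      using stable_set_trajectory[OF f p2 S] by auto
    let ?w = "\<lambda>s. u s - v s"
    have "exp (E / (2 * a) * (S - 0)) * H (?w 0) \<le> H (?w S)"
    proof (rule gronwall_lower_bound[OF S,
          where h' = "\<lambda>s. 2 * (?w s \<bullet> (Q *v (f (t1 + s) (u s) - f (t2 + s) (v s))))"])
      fix s assume s: "s \<in> {0..S}"
      show "((\<lambda>s. H (?w s)) has_real_derivative
          2 * (?w s \<bullet> (Q *v (f (t1 + s) (u s) - f (t2 + s) (v s))))) (at s within {0..S})"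
        using DERIV_diff[OF has_real_derivative_quadratic_form[OF matrix_vector_mul_bounded_linear
            symmetric_matrix_inner[OF Q] has_vector_derivative_diff[OF du[OF s] dv[OF s]]] DERIV_const]
        by (simp add: H_def)
      define r where "r = norm (?w s)"
      have "E * r\<^sup>2 \<le> 2 * (?w s \<bullet> (Q *v (f (t1 + s) (u s) - f (t1 + s) (v s))))"
        unfolding r_def using s \<open>t1 \<ge> t0\<close>
        by (intro cone_lower_bound_increment[OF f \<open>convex N\<close> Q] cone uN vN) auto
      moreover have "2 * \<bar>?w s \<bullet> (Q *v (f (t1 + s) (v s) - f (t2 + s) (v s)))\<bar> \<le> D * r"
        unfolding r_def using s vN by (intro time) auto
      ultimately have "E * r\<^sup>2 - D * r \<le> 2 * (?w s \<bullet> (Q *v (f (t1 + s) (u s) - f (t2 + s) (v s))))"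
        unfolding matrix_vector_mult_diff_distrib inner_diff_right by (rule arith)
      \<comment> \<open>AM-GM: \<open>D r \<le> E r\<^sup>2 / 2 + D\<^sup>2 / (2 E)\<close>\<close>
      moreover have "E / 2 * r\<^sup>2 - D\<^sup>2 / (2 * E) \<le> E * r\<^sup>2 - D * r"
      proof -
        have "0 \<le> (E * r - D)\<^sup>2 / (2 * E)" using \<open>E > 0\<close> by simp
        also have "\<dots> = E * r\<^sup>2 - D * r - (E / 2 * r\<^sup>2 - D\<^sup>2 / (2 * E))"
          using \<open>E > 0\<close> by (simp add: field_simps power2_eq_square)
        finally show ?thesis by simp
      qed
      moreover have "E / (2 * a) * H (?w s) \<le> E / 2 * r\<^sup>2 - D\<^sup>2 / (2 * E)"
      proof -
        have "H (?w s) \<le> a * r\<^sup>2 - a * D\<^sup>2 / E\<^sup>2"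
          unfolding H_def r_def using form_le by simp
        then have "E / (2 * a) * H (?w s) \<le> E / (2 * a) * (a * r\<^sup>2 - a * D\<^sup>2 / E\<^sup>2)"
          using \<open>a > 0\<close> \<open>E > 0\<close> by (intro mult_left_mono) auto
        also have "\<dots> = E / 2 * r\<^sup>2 - D\<^sup>2 / (2 * E)"
          using \<open>a > 0\<close> \<open>E > 0\<close> by (simp add: field_simps power2_eq_square)
        finally show ?thesis .
      qed
      ultimately show "E / (2 * a) * H (?w s)
          \<le> 2 * (?w s \<bullet> (Q *v (f (t1 + s) (u s) - f (t2 + s) (v s))))"
        by linarith
    qed
    \<comment> \<open>The initial value is positive, so the exponential factor can be replaced by
      1.\<close>
    moreover have "1 * H (?w 0) \<le> exp (E / (2 * a) * (S - 0)) * H (?w 0)"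
      using pos u v \<open>a > 0\<close> \<open>E > 0\<close> S by (intro mult_right_mono) auto
    ultimately show ?thesis using u v by (simp add: q_def)
  qed
  have shift: "((\<lambda>S. the (phi f (t + S) t p)) \<longlongrightarrow> z0) at_top" if "p \<in> stable_set f N z0 t" for t p
  proof -
    have "((\<lambda>\<tau>. the (phi f \<tau> t p)) \<longlongrightarrow> z0) at_top"
      using that by (simp add: stable_set_def)
    then show ?thesis
      by (rule filterlim_compose) (rule filterlim_tendsto_add_at_top[OF tendsto_const filterlim_ident])
  qed
  \<comment> \<open>The common limit \<open>z0\<close> makes the difference tend to 0, where
    \<open>H\<close> is at most 0, against the positive lower bound just found.\<close>
  have "(q \<longlongrightarrow> z0 - z0) at_top"
    unfolding q_def by (intro tendsto_diff shift p1 p2)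
  then have "((\<lambda>S. H (q S)) \<longlongrightarrow> H 0) at_top"
    unfolding H_def
    by (intro tendsto_intros bounded_linear.tendsto[OF matrix_vector_mul_bounded_linear]) auto
  moreover have "eventually (\<lambda>S. H (p1 - p2) \<le> H (q S)) at_top"
    by (rule eventually_mono[OF eventually_ge_at_top[of 0] growth])
  ultimately have "H (p1 - p2) \<le> H 0"
    by (rule tendsto_lowerbound) simp
  moreover have "H 0 \<le> 0" using \<open>a > 0\<close> by (simp add: H_def)
  ultimately show False using pos by simp
qed

section \<open>The constant m in the extended reals\<close>

lemma m_const_bound:
  assumes "t \<ge> t0" "z \<in> N"
  shows "ereal (bilin_norm (lie_vec Q (pd_t f t z))) \<le> m_const f N Q t0"
  unfolding m_const_def using assms by (intro SUP_upper2[of "(t, z)"]) auto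

text \<open>Over an empty \<open>N\<close> the supremum would be \<open>-\<infinity>\<close>; any
  point of \<open>N\<close> excludes this.\<close>

lemma m_const_nonneg:
  fixes N :: "(real ^ 'n) set"
  assumes "N \<noteq> {}"
  shows "0 \<le> m_const f N Q t0"
proof -
  obtain z where "z \<in> N" using assms by blast
  have "0 \<le> \<bar>lie_vec Q (pd_t f t0 z) 0 0\<bar>" by simp
  also have "\<dots> \<le> bilin_norm (lie_vec Q (pd_t f t0 z))"
    by (rule abs_lie_vec_le_bilin_norm) auto
  finally have "0 \<le> ereal (bilin_norm (lie_vec Q (pd_t f t0 z)))" by simp
  also have "\<dots> \<le> m_const f N Q t0" by (rule m_const_bound) (use \<open>z \<in> N\<close> in auto)
  finally show ?thesis .
qed

text \<open>A finite value \<open>M\<close> of m allows \<open>D = M * \<bar>t1 - t2\<bar>\<close>.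
  If m is infinite, the right-hand side is infinite unless \<open>t1 = t2\<close>.\<close>

lemma stable_set_form_bound_m_const:
  fixes f :: "real \<Rightarrow> real ^ 'n \<Rightarrow> real ^ 'n"
  assumes f: "C1 (\<lambda>(t, z). f t z)" and "convex N" and Q: "transpose Q = Q"
    and "a > 0" and form_le: "\<And>v. v \<bullet> (Q *v v) \<le> a * (norm v)\<^sup>2"
    and "E > 0"
    and cone: "\<And>t z v. t \<ge> t0 \<Longrightarrow> z \<in> N \<Longrightarrow> E * (norm v)\<^sup>2 \<le> v \<bullet> (lie Q (pd_z f t z) *v v)"
    and "t1 \<ge> t0" "t2 \<ge> t0"
    and p1: "p1 \<in> stable_set f N z0 t1" and p2: "p2 \<in> stable_set f N z0 t2"
  shows "ereal ((p1 - p2) \<bullet> (Q *v (p1 - p2)))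
    \<le> ereal a * (m_const f N Q t0)\<^sup>2 / ereal (E\<^sup>2) * ereal ((t1 - t2)\<^sup>2)"
proof -
  have bound: "(p1 - p2) \<bullet> (Q *v (p1 - p2)) \<le> a * D\<^sup>2 / E\<^sup>2"
    if "\<And>s z v. s \<ge> 0 \<Longrightarrow> z \<in> N \<Longrightarrow> 2 * \<bar>v \<bullet> (Q *v (f (t1 + s) z - f (t2 + s) z))\<bar> \<le> D * norm v"
    for D
    by (rule stable_set_form_bound[OF f assms(2) Q assms(4) form_le assms(6) cone that assms(8) p1 p2])
  have "phi f (t1 + 0) t1 p1 \<in> Some ` N"
    using p1 unfolding stable_set_def by blast
  then have m0: "0 \<le> m_const f N Q t0" by (intro m_const_nonneg) auto
  show ?thesis
  proof (cases "m_const f N Q t0")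
    case (real M)
    have "2 * \<bar>v \<bullet> (Q *v (f (t1 + s) z - f (t2 + s) z))\<bar> \<le> (M * \<bar>t1 - t2\<bar>) * norm v"
      if "s \<ge> 0" "z \<in> N" for s z v
    proof -
      \<comment> \<open>The half offsets the two equal terms counted in the norm of
        \<open>lie_vec\<close>.\<close>
      have "\<bar>v \<bullet> (Q *v pd_t f t z)\<bar> \<le> M * norm v / 2" if "t \<ge> t0" for t
      proof -
        have "bilin_norm (lie_vec Q (pd_t f t z)) \<le> M"
          using m_const_bound[OF that \<open>z \<in> N\<close>, of Q f] real by simp
        then have "bilin_norm (lie_vec Q (pd_t f t z)) * norm v \<le> M * norm v"
          by (intro mult_right_mono) auto
        then show ?thesis
          using inner_le_bilin_norm_lie_vec[OF Q, of v "pd_t f t z"] by simp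
      qed
      from time_increment_bound[OF f this, where ?s1.0 = "t1 + s" and ?s2.0 = "t2 + s"]
      have "\<bar>v \<bullet> (Q *v (f (t1 + s) z - f (t2 + s) z))\<bar> \<le> M * norm v / 2 * \<bar>t1 - t2\<bar>"
        using \<open>s \<ge> 0\<close> \<open>t1 \<ge> t0\<close> \<open>t2 \<ge> t0\<close> by simp
      then show ?thesis by (simp add: mult_ac)
    qed
    from bound[OF this] show ?thesis
      using \<open>E > 0\<close> real by (simp add: power_mult_distrib)
  next
    case PInf
    show ?thesis
    proof (cases "t1 = t2")
      case True
      \<comment> \<open>Here the right-hand side is \<open>\<infinity> * 0 = 0\<close>, and the time
        increment vanishes identically, so \<open>D = 0\<close> is admissible.\<close>
      then show ?thesis using bound[of 0] by (simp add: zero_ereal_def[symmetric])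
    next
      case False
      then show ?thesis using PInf \<open>a > 0\<close> \<open>E > 0\<close> by (simp add: power2_eq_square)
    qed
  next
    case MInf
    then show ?thesis using m0 by simp
  qed
qed

section \<open>The cone condition on compact time intervals\<close>

text \<open>Compactness of \<open>N\<close> bounds each entry of the Jacobian, so the infima and
  suprema really enclose its values.\<close>

lemma pd_z_in_interval_jacobian:
  fixes f :: "real \<Rightarrow> real ^ 'n \<Rightarrow> real ^ 'n"
  assumes f: "C1 (\<lambda>(t, z). f t z)" and "compact N" and "z \<in> N"
  shows "pd_z f t z \<in> interval_jacobian f N t"
proof -
  have "bounded ((\<lambda>z. pd_z f t z $ i $ j) ` N)" for i j
  proof -
    have "continuous_on N ((\<lambda>(t, z). pd_z f t z) \<circ> (\<lambda>z. (t, z)))"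
      by (intro continuous_on_compose continuous_intros continuous_on_subset[OF C1_continuous_pd_z[OF f]]) auto
    then have "continuous_on N (\<lambda>z. pd_z f t z $ i $ j)"
      by (auto simp: o_def intro!: continuous_intros)
    then show ?thesis
      using \<open>compact N\<close> compact_continuous_image compact_imp_bounded by blast
  qed
  then show ?thesis
    unfolding interval_jacobian_def using \<open>z \<in> N\<close>
    by (auto intro!: cINF_lower cSUP_upper bounded_imp_bdd_above bounded_imp_bdd_below)
qed

text \<open>\<open>E\<close> is the minimum of a continuous positive function on the product of
  \<open>{t0..T}\<close>, \<open>N\<close> and the unit sphere; quadratic homogeneity extends the
  bound to all \<open>v\<close>. Compactness in time is why \<open>E\<close> may depend on
  \<open>T\<close>.\<close>

lemma cone_condition_uniform:
  fixes f :: "real \<Rightarrow> real ^ 'n \<Rightarrow> real ^ 'n"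
  assumes f: "C1 (\<lambda>(t, z). f t z)" and "compact N" and Q: "transpose Q = Q"
    and cone: "cone_condition f N Q t0"
  shows "\<exists>E>0. \<forall>t\<in>{t0..T}. \<forall>z\<in>N. \<forall>v. E * (norm v)\<^sup>2 \<le> v \<bullet> (lie Q (pd_z f t z) *v v)"
proof (cases "{t0..T} \<times> N = {}")
  case True
  then have "\<forall>t\<in>{t0..T}. \<forall>z\<in>N. \<forall>v. 1 * (norm v)\<^sup>2 \<le> v \<bullet> (lie Q (pd_z f t z) *v v)"
    by blast
  then show ?thesis using zero_less_one by blast
next
  case False
  define K where "K = ({t0..T} \<times> N) \<times> sphere (0 :: real ^ 'n) 1"
  define g where "g = (\<lambda>((t, z), v). v \<bullet> (lie Q (pd_z f t z) *v v))"
  have K: "compact K"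
    unfolding K_def by (intro compact_Times compact_Icc compact_sphere \<open>compact N\<close>)
  have "axis undefined 1 \<in> sphere (0 :: real ^ 'n) 1" by simp
  then have ne: "K \<noteq> {}" using False unfolding K_def by blast
  have "continuous_on K g"
  proof -
    have "continuous_on K ((\<lambda>(t, z). pd_z f t z) \<circ> fst)"
      by (intro continuous_on_compose continuous_intros continuous_on_subset[OF C1_continuous_pd_z[OF f]]) auto
    then have "continuous_on K (\<lambda>p. pd_z f (fst (fst p)) (snd (fst p)))"
      by (simp add: o_def split_def)
    then show ?thesis
      unfolding g_def split_def lie_quadratic_form[OF Q]
      unfolding matrix_vector_mult_def
      by (intro continuous_intros) auto
  qed
  from continuous_attains_inf[OF K ne this]
  obtain p where p: "p \<in> K" "\<And>q. q \<in> K \<Longrightarrow> g p \<le> g q" by blast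
  have "g p > 0"
  proof -
    obtain t z v where "p = ((t, z), v)" by (metis prod.exhaust)
    with p(1) have "t \<ge> t0" "z \<in> N" "norm v = 1" by (auto simp: K_def)
    then have "pos_def_mat (lie Q (pd_z f t z))"
      using cone pd_z_in_interval_jacobian[OF f \<open>compact N\<close>] unfolding cone_condition_def by blast
    moreover have "v \<noteq> 0" using \<open>norm v = 1\<close> by auto
    ultimately show ?thesis
      by (simp add: \<open>p = ((t, z), v)\<close> g_def pos_def_mat_def)
  qed
  moreover have "g p * (norm v)\<^sup>2 \<le> v \<bullet> (lie Q (pd_z f t z) *v v)"
    if "t \<in> {t0..T}" "z \<in> N" for t z v
  proof (cases "v = 0")
    case False
    then have "g p \<le> g ((t, z), v /\<^sub>R norm v)"
      using that by (intro p) (auto simp: K_def)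
    also have "\<dots> = (v \<bullet> (lie Q (pd_z f t z) *v v)) / (norm v)\<^sup>2"
      by (simp add: g_def matrix_vector_mult_scaleR power2_eq_square divide_inverse)
    finally show ?thesis using False by (simp add: field_simps)
  qed simp
  ultimately show ?thesis by blast
qed

section \<open>Product coordinates and the block\<close>

lemma join_diff: "join x y - join x' y' = join (x - x') (y - y')"
  by (auto simp: join_def vec_eq_iff split: sum.split)

lemma join_surj: "\<exists>x y. z = join x y"
  by (intro exI[of _ "\<chi> i. z $ Inl i"] exI[of _ "\<chi> j. z $ Inr j"])
    (auto simp: join_def vec_eq_iff split: sum.split)

lemma linear_join: "linear (\<lambda>(x, y). join x y)"
  by (rule linearI) (auto simp: join_def vec_eq_iff split: sum.split)

lemma norm_join:
  fixes x :: "real ^ 'u::finite" and y :: "real ^ 's::finite"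
  shows "(norm (join x y))\<^sup>2 = (norm x)\<^sup>2 + (norm y)\<^sup>2"
proof -
  \<comment> \<open>With \<open>b = - 1\<close> both diagonal blocks are identities, so the formula
    for the quadratic form becomes Pythagoras.\<close>
  have "(Qmat 1 (- 1) :: real ^ ('u + 's) ^ ('u + 's)) = mat 1"
    by (auto simp: Qmat_def mat_def vec_eq_iff split: sum.split)
  then show ?thesis
    using Qmat_quadratic_form[of x y 1 "- 1"] by (simp add: dot_square_norm)
qed

lemma Qmat_quadratic_form_le:
  assumes "a \<ge> 0" "b \<ge> 0"
  shows "v \<bullet> (Qmat a b *v v) \<le> a * (norm v)\<^sup>2"
proof -
  obtain x y where v: "v = join x y" using join_surj by blast
  have "0 \<le> a * (norm y)\<^sup>2" "0 \<le> b * (norm y)\<^sup>2" using assms by auto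
  then show ?thesis
    unfolding v Qmat_quadratic_form norm_join by (simp add: distrib_left)
qed

lemma block_eq_image: "block px rx py ry = (\<lambda>(x, y). join x y) ` (cball px rx \<times> cball py ry)"
  unfolding block_def by fast

lemma convex_block: "convex (block px rx py ry)"
  unfolding block_eq_image
  by (intro convex_linear_image linear_join convex_Times convex_cball)

lemma compact_block: "compact (block px rx py ry)"
  unfolding block_eq_image
  by (intro compact_continuous_image linear_continuous_on compact_Times compact_cball)
    (simp add: linear_join linear_linear)

text \<open>The pointwise cone condition yields \<open>E\<close> on each \<open>{t0..T}\<close>; a
  bound for all \<open>t \<ge> t0\<close> therefore enters the estimates as a premise on
  \<open>E\<close>.\<close>

theorem lemma4:
  fixes f :: "real \<Rightarrow> real ^ ('u::finite + 's::finite) \<Rightarrow> real ^ ('u + 's)"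
    and z0 :: "real ^ ('u + 's)"
    and px :: "real ^ 'u" and py :: "real ^ 's"
    and rx ry t0 a b :: real
    and N :: "(real ^ ('u + 's)) set"
    and Q :: "real ^ ('u + 's) ^ ('u + 's)"
  assumes f_C1: "C1 (\<lambda>(t, z). f t z)"
    and equilibrium: "\<And>t. f t z0 = 0"
    and N_eq: "N = block px rx py ry"
    and z0_int: "z0 \<in> interior N"
    and "a > 0" and "b > 0"
    and Q_eq: "Q = Qmat a b"
    and isolating: "isolating_block f px rx py ry {t0..}"
    and cone: "cone_condition f N Q t0"
  shows
    "(\<forall>T\<ge>t0. \<exists>E>0. \<forall>t\<in>{t0..T}. \<forall>z\<in>N. \<forall>v.
        v \<bullet> (lie Q (pd_z f t z) *v v) \<ge> E * (norm v)\<^sup>2) \<and>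
     (\<forall>E>0. (\<forall>t\<ge>t0. \<forall>z\<in>N. \<forall>v. v \<bullet> (lie Q (pd_z f t z) *v v) \<ge> E * (norm v)\<^sup>2) \<longrightarrow>
        (let m = m_const f N Q t0; \<delta> = ereal a * m\<^sup>2 / ereal (E\<^sup>2) in
          (\<forall>t1\<ge>t0. \<forall>t2\<ge>t0. \<forall>x1 y1 x2 y2.
             join x1 y1 \<in> stable_set f N z0 t1 \<and> join x2 y2 \<in> stable_set f N z0 t2 \<longrightarrow>
             ereal (a * (norm (x1 - x2))\<^sup>2)
               \<le> \<delta> * ereal ((t1 - t2)\<^sup>2) + ereal (b * (norm (y1 - y2))\<^sup>2)) \<and>
          (\<forall>xs. (\<forall>t\<ge>t0. stable_set f N z0 t = {join (xs t y) y | y. y \<in> cball py ry}) \<longrightarrow>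
             (\<forall>t1\<ge>t0. \<forall>t2\<ge>t0. \<forall>y\<in>cball py ry.
                ereal (norm (xs t1 y - xs t2 y)) \<le> m / ereal E * ereal \<bar>t1 - t2\<bar>))))"
proof (intro conjI allI impI)
  have convex: "convex N" and compact: "compact N"
    unfolding N_eq by (rule convex_block compact_block)+
  have Q_sym: "transpose Q = Q"
    unfolding Q_eq by (rule transpose_Qmat)
  show "\<exists>E>0. \<forall>t\<in>{t0..T}. \<forall>z\<in>N. \<forall>v. v \<bullet> (lie Q (pd_z f t z) *v v) \<ge> E * (norm v)\<^sup>2" for T
    by (rule cone_condition_uniform[OF f_C1 compact Q_sym cone])
  fix E :: real
  assume "E > 0"
    and E: "\<forall>t\<ge>t0. \<forall>z\<in>N. \<forall>v. v \<bullet> (lie Q (pd_z f t z) *v v) \<ge> E * (norm v)\<^sup>2"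
  define m where "m = m_const f N Q t0"
  define \<delta> where "\<delta> = ereal a * m\<^sup>2 / ereal (E\<^sup>2)"
  have pairs: "ereal (a * (norm (x1 - x2))\<^sup>2) \<le> \<delta> * ereal ((t1 - t2)\<^sup>2) + ereal (b * (norm (y1 - y2))\<^sup>2)"
    if "t1 \<ge> t0" "t2 \<ge> t0"
      and "join x1 y1 \<in> stable_set f N z0 t1" "join x2 y2 \<in> stable_set f N z0 t2"
    for t1 t2 x1 y1 x2 y2
  proof -
    have "v \<bullet> (Q *v v) \<le> a * (norm v)\<^sup>2" for v
      unfolding Q_eq using \<open>a > 0\<close> \<open>b > 0\<close> by (intro Qmat_quadratic_form_le) auto
    from stable_set_form_bound_m_const[OF f_C1 convex Q_sym \<open>a > 0\<close> this \<open>E > 0\<close> E[rule_format] that]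
    have "ereal (a * (norm (x1 - x2))\<^sup>2 - b * (norm (y1 - y2))\<^sup>2) \<le> \<delta> * ereal ((t1 - t2)\<^sup>2)"
      unfolding join_diff Q_eq Qmat_quadratic_form \<delta>_def m_def .
    then show ?thesis
      \<comment> \<open>The case split is there because this product may be infinite.\<close>
      by (cases "\<delta> * ereal ((t1 - t2)\<^sup>2)") auto
  qed
  have "N \<noteq> {}" using z0_int interior_subset by blast
  then have "m \<ge> 0" unfolding m_def by (rule m_const_nonneg)
  have graph: "ereal (norm (xs t1 y - xs t2 y)) \<le> m / ereal E * ereal \<bar>t1 - t2\<bar>"
    if xs: "\<forall>t\<ge>t0. stable_set f N z0 t = {join (xs t y) y | y. y \<in> cball py ry}"
      and t: "t1 \<ge> t0" "t2 \<ge> t0" and y: "y \<in> cball py ry"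
    for xs t1 t2 y
  proof (cases m)
    case (real M)
    \<comment> \<open>Both points have the same \<open>y\<close>, so the term with \<open>b\<close>
      vanishes; cancelling \<open>a\<close> and taking roots gives the Lipschitz bound.\<close>
    have "ereal (a * (norm (xs t1 y - xs t2 y))\<^sup>2) \<le> \<delta> * ereal ((t1 - t2)\<^sup>2)"
      using pairs[of t1 t2 "xs t1 y" y "xs t2 y" y] xs t y by auto
    then have "a * (norm (xs t1 y - xs t2 y))\<^sup>2 \<le> a * (M / E * \<bar>t1 - t2\<bar>)\<^sup>2"
      using \<open>E > 0\<close> by (simp add: \<delta>_def real power_mult_distrib power_divide)
    then have "(norm (xs t1 y - xs t2 y))\<^sup>2 \<le> (M / E * \<bar>t1 - t2\<bar>)\<^sup>2"
      by (rule mult_left_le_imp_le[OF _ \<open>a > 0\<close>])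
    moreover have "0 \<le> M / E * \<bar>t1 - t2\<bar>"
      using \<open>m \<ge> 0\<close> \<open>E > 0\<close> by (simp add: real)
    ultimately have "norm (xs t1 y - xs t2 y) \<le> M / E * \<bar>t1 - t2\<bar>"
      by (rule power2_le_imp_le)
    then show ?thesis using \<open>E > 0\<close> by (simp add: real)
  next
    case PInf
    \<comment> \<open>For equal times both sides are 0; otherwise the right-hand side is
      infinite.\<close>
    then show ?thesis using \<open>E > 0\<close> by (cases "t1 = t2") auto
  next
    case MInf
    then show ?thesis using \<open>m \<ge> 0\<close> by simp
  qed
  show "let m = m_const f N Q t0; \<delta> = ereal a * m\<^sup>2 / ereal (E\<^sup>2) in
          (\<forall>t1\<ge>t0. \<forall>t2\<ge>t0. \<forall>x1 y1 x2 y2.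
             join x1 y1 \<in> stable_set f N z0 t1 \<and> join x2 y2 \<in> stable_set f N z0 t2 \<longrightarrow>
             ereal (a * (norm (x1 - x2))\<^sup>2)
               \<le> \<delta> * ereal ((t1 - t2)\<^sup>2) + ereal (b * (norm (y1 - y2))\<^sup>2)) \<and>
          (\<forall>xs. (\<forall>t\<ge>t0. stable_set f N z0 t = {join (xs t y) y | y. y \<in> cball py ry}) \<longrightarrow>
             (\<forall>t1\<ge>t0. \<forall>t2\<ge>t0. \<forall>y\<in>cball py ry.
                ereal (norm (xs t1 y - xs t2 y)) \<le> m / ereal E * ereal \<bar>t1 - t2\<bar>))"
    unfolding Let_def m_def[symmetric] \<delta>_def[symmetric]
    by (intro conjI allI impI ballI pairs graph) auto
qed

end
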